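(* For every integer $k \geq 1$ and every real $t \geq 0$, the Bateman function $F_k$ satisfies the integral representation $$F_k(t) = \frac{1}{\pi} \int_{-\infty}^{\infty} e^{it\tau}\, \frac{(\tau + i)^{k-1}}{(\tau - i)^{k+1}}\, d\tau$$ and therefore the residual representation $$F_k(t) = 2i \,\operatorname{Res}_{z=i}\left(e^{itz}\,\frac{(z + i)^{k-1}}{(z - i)^{k+1}}\right).$$
   Context: The functions $F_k$ ($k \in \{0,1,2,\ldots\}$, called Bateman functions) are defined as the Taylor coefficients, for $z$ in the open unit disk of $\mathbb{C}$, in the generating function $$e^{-t\,\frac{1+z}{1-z}} = \sum_{k=0}^{\infty} F_k(t)\, z^k .$$ $\operatorname{Res}_{z=i}$ denotes the residue at the point $z=i$. *)

theory Defs
  imports "HOL-Complex_Analysis.Complex_Analysis"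
begin

definition bateman_gen :: "real \<Rightarrow> complex \<Rightarrow> complex" where
  "bateman_gen t z = exp (- of_real t * ((1 + z) / (1 - z)))"

text \<open>The Taylor coefficients at 0 of the generating function, taken as complex numbers.\<close>

definition bateman :: "nat \<Rightarrow> real \<Rightarrow> complex" where
  "bateman k t = (deriv ^^ k) (bateman_gen t) 0 / fact k"

lemma bateman_sums:
  assumes "norm z < 1"
  shows "(\<lambda>k. bateman k t * z ^ k) sums exp (- of_real t * ((1 + z) / (1 - z)))"
proof -
  have "bateman_gen t holomorphic_on ball 0 1"
    unfolding bateman_gen_def by (intro holomorphic_intros) auto
  moreover have "z \<in> ball 0 1"
    using assms by simp
  ultimately have "(\<lambda>k. (deriv ^^ k) (bateman_gen t) 0 / fact k * (z - 0) ^ k) sums bateman_gen t z"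
    by (rule holomorphic_power_series)
  then show ?thesis
    by (simp add: bateman_def bateman_gen_def)
qed

end

theory Submission
  imports Defs "HOL-Probability.Sinc_Integral"
begin

text \<open>
  The Moebius map \<open>z = \<i> (1 + w) / (1 - w)\<close> turns the generating function into
  \<open>exp (\<i> t z)\<close> and \<open>dw / w ^ (k + 1)\<close> into a constant multiple of
  \<open>(z + \<i>) ^ (k - 1) / (z - \<i>) ^ (k + 1) dz\<close>. Cauchy's formula for the Taylor coefficients on a
  circle about 0 becomes the residue at \<open>\<i>\<close>. For \<open>t \<ge> 0\<close> the generating function is bounded by 1
  on the closed disk, so by dominated convergence Cauchy's formula extends to the unit circle, which
  the same map sends to the real line.
\<close>

section \<open>Circles inside the disk and the residue formula\<close>

lemma bateman_circlepath:
  fixes r :: real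
  assumes "0 < r" "r < 1"
  shows "((\<lambda>w. bateman_gen t w / w ^ Suc k) has_contour_integral 2 * pi * \<i> * bateman k t)
           (circlepath 0 r)"
proof -
  have hol: "bateman_gen t holomorphic_on ball 0 1"
    unfolding bateman_gen_def by (intro holomorphic_intros) auto
  have "((\<lambda>w. bateman_gen t w / (w - 0) ^ Suc k) has_contour_integral
          2 * pi * \<i> / fact k * (deriv ^^ k) (bateman_gen t) 0) (circlepath 0 r)"
  proof (rule Cauchy_has_contour_integral_higher_derivative_circlepath)
    show "continuous_on (cball 0 r) (bateman_gen t)"
      using holomorphic_on_imp_continuous_on[OF hol] by (rule continuous_on_subset) (use assms in auto)
    show "bateman_gen t holomorphic_on ball 0 r"
      using hol by (rule holomorphic_on_subset) (use assms in auto)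
  qed (use assms in auto)
  then show ?thesis
    by (simp add: bateman_def)
qed

text \<open>With \<open>c = 2i / (1 - w)\<close> one has \<open>z + i = c\<close> and
  \<open>z - i = c * w\<close>, so the quotient of powers collapses to
  \<open>1 / (c^2 * w^(k+1))\<close>. The remaining factor \<open>1 / c^2\<close> is, up to the
  constant \<open>1 / (2i)\<close>, the reciprocal of \<open>dz/dw = 2i / (1 - w)^2\<close>. The
  identity serves both on small circles and on the unit circle.\<close>

lemma cayley_integrand:
  fixes w :: complex
  assumes "w \<noteq> 1" "w \<noteq> 0" "k \<ge> 1"
  defines "z \<equiv> \<i> * (1 + w) / (1 - w)"
  shows "exp (\<i> * of_real t * z) * ((z + \<i>) ^ (k - 1) / (z - \<i>) ^ (k + 1)) =
           bateman_gen t w / w ^ Suc k * ((1 - w)\<^sup>2 / (2 * \<i>)\<^sup>2)"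
proof -
  have e: "exp (\<i> * of_real t * z) = bateman_gen t w"
    by (simp add: z_def bateman_gen_def flip: mult.assoc) (simp add: mult_ac)
  have p: "z + \<i> = 2 * \<i> / (1 - w)" and q: "z - \<i> = 2 * \<i> / (1 - w) * w"
    using assms by (simp_all add: divide_simps) (simp_all add: algebra_simps)
  define c where "c = 2 * \<i> / (1 - w)"
  have "c \<noteq> 0" using assms by (simp add: c_def)
  obtain m where k: "k = Suc m" using assms(3) by (cases k) auto
  have "(z + \<i>) ^ (k - 1) / (z - \<i>) ^ (k + 1) = c ^ (k - 1) / (c ^ (k + 1) * w ^ Suc k)"
    unfolding p q c_def[symmetric] by (simp add: power_mult_distrib)
  also have "\<dots> = 1 / w ^ Suc k * (1 / c\<^sup>2)"
    using \<open>c \<noteq> 0\<close> \<open>w \<noteq> 0\<close> by (simp add: k field_simps power2_eq_square)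
  also have "1 / c\<^sup>2 = (1 - w)\<^sup>2 / (2 * \<i>)\<^sup>2"
    by (simp add: c_def power_divide)
  finally show ?thesis
    by (simp add: e)
qed

text \<open>The residue theorem is applied to the image of a small circle under the Moebius map
  \<open>h\<close>. The shape of that image does not matter: only its winding number about
  \<open>i = h 0\<close> enters, and pulling back along \<open>h\<close> computes it.\<close>

lemma bateman_eq_residue:
  assumes "k \<ge> 1"
  shows "bateman k t = 2 * \<i> *
    residue (\<lambda>z. exp (\<i> * of_real t * z) * ((z + \<i>) ^ (k - 1) / (z - \<i>) ^ (k + 1))) \<i>"
proof -
  define f where "f = (\<lambda>z. exp (\<i> * of_real t * z) * ((z + \<i>) ^ (k - 1) / (z - \<i>) ^ (k + 1)))"
  define h where "h = (\<lambda>w::complex. \<i> * (1 + w) / (1 - w))"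
  define \<gamma> where "\<gamma> = circlepath 0 (1/2)"
  have im: "path_image \<gamma> = sphere 0 (1/2)" and vp: "valid_path \<gamma>"
    by (simp_all add: \<gamma>_def)
  have holh: "h holomorphic_on ball 0 1"
    unfolding h_def by (intro holomorphic_intros) auto
  then have anh: "h analytic_on ball 0 1"
    by (simp add: analytic_on_open)
  have sub: "path_image \<gamma> \<subseteq> ball 0 1"
    unfolding im by auto
  have w01: "w \<noteq> 0" "w \<noteq> 1" if "w \<in> path_image \<gamma>" for w
    using that by (auto simp: im)
  have dh: "deriv h w = 2 * \<i> / (1 - w)\<^sup>2" if "w \<noteq> 1" for w
  proof -
    have "(h has_field_derivative (\<i> * (1 - w) - \<i> * (1 + w) * (- 1)) / ((1 - w) * (1 - w))) (at w)"
      unfolding h_def using that by (auto intro!: derivative_eq_intros)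
    then show ?thesis
      by (simp add: DERIV_imp_deriv power2_eq_square algebra_simps)
  qed
  have hi: "h w - \<i> = 2 * \<i> * w / (1 - w)" if "w \<noteq> 1" for w
    using that by (simp add: h_def divide_simps) (simp add: algebra_simps)
  have vph: "valid_path (h \<circ> \<gamma>)"
    using vp holh sub by (intro valid_path_compose_holomorphic[where S = "ball 0 1"]) auto
  have noti: "\<i> \<notin> path_image (h \<circ> \<gamma>)"
    using hi w01 by (force simp: path_image_compose)
  \<comment> \<open>Pulled back, \<open>dz / (z - i)\<close> is \<open>dw / (w * (1 - w))\<close>,
    so Cauchy's formula for \<open>1 / (1 - w)\<close> at 0 gives winding number 1.\<close>
  have "contour_integral (h \<circ> \<gamma>) (\<lambda>z. 1 / (z - \<i>))
      = contour_integral \<gamma> (\<lambda>w. deriv h w * (1 / (h w - \<i>)))"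
    by (rule contour_integral_comp_analyticW[OF anh vp sub])
  also have "\<dots> = contour_integral \<gamma> (\<lambda>w. 1 / (1 - w) / (w - 0))"
  proof (intro contour_integral_cong refl)
    fix w assume "w \<in> path_image \<gamma>"
    then have "1 - w \<noteq> 0" "w \<noteq> 0"
      using w01 by auto
    then show "deriv h w * (1 / (h w - \<i>)) = 1 / (1 - w) / (w - 0)"
      by (simp add: dh hi power2_eq_square)
  qed
  also have "\<dots> = 2 * pi * \<i> * (1 / (1 - 0))"
  proof -
    have "(\<lambda>w::complex. 1 / (1 - w)) holomorphic_on ball 0 1"
      by (intro holomorphic_intros) auto
    then have "(\<lambda>w::complex. 1 / (1 - w)) holomorphic_on cball 0 (1/2)"
      by (rule holomorphic_on_subset) auto
    then have "((\<lambda>w::complex. 1 / (1 - w) / (w - 0)) has_contour_integral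
        2 * complex_of_real pi * \<i> * (1 / (1 - 0))) \<gamma>"
      unfolding \<gamma>_def
      by (rule Cauchy_integral_circlepath_simple) simp
    from contour_integral_unique[OF this] show ?thesis by simp
  qed
  finally have wn: "winding_number (h \<circ> \<gamma>) \<i> = 1"
    by (simp add: winding_number_valid_path[OF vph noti])
  have "contour_integral (h \<circ> \<gamma>) f
      = 2 * pi * \<i> * (\<Sum>p\<in>{\<i>}. winding_number (h \<circ> \<gamma>) p * residue f p)"
  proof (rule Residue_theorem[where S = UNIV])
    show "f holomorphic_on UNIV - {\<i>}"
      unfolding f_def by (intro holomorphic_intros) auto
    show "pathfinish (h \<circ> \<gamma>) = pathstart (h \<circ> \<gamma>)"
      by (simp add: pathfinish_compose pathstart_compose \<gamma>_def)
  qed (use vph noti in auto)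
  moreover have "contour_integral (h \<circ> \<gamma>) f = contour_integral \<gamma> (\<lambda>w. deriv h w * f (h w))"
    by (rule contour_integral_comp_analyticW[OF anh vp sub])
  \<comment> \<open>The derivative \<open>2i / (1 - w)^2\<close> cancels the factor
    \<open>(1 - w)^2 / (2i)^2\<close> of \<open>cayley_integrand\<close> down to
    \<open>1 / (2i)\<close>, the source of the \<open>2i\<close> in the residue formula.\<close>
  moreover have "\<dots> = contour_integral \<gamma> (\<lambda>w. 1 / (2 * \<i>) * (bateman_gen t w / w ^ Suc k))"
  proof (intro contour_integral_cong refl)
    fix w assume "w \<in> path_image \<gamma>"
    note w = w01[OF this]
    have "deriv h w * f (h w) = 2 * \<i> / (1 - w)\<^sup>2 *
        (bateman_gen t w / w ^ Suc k * ((1 - w)\<^sup>2 / (2 * \<i>)\<^sup>2))"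
      unfolding f_def h_def cayley_integrand[OF w(2,1) assms]
      using dh[OF w(2)] by (simp add: h_def)
    also have "\<dots> = 1 / (2 * \<i>) * (bateman_gen t w / w ^ Suc k)"
      using w by (simp add: power2_eq_square)
    finally show "deriv h w * f (h w) = 1 / (2 * \<i>) * (bateman_gen t w / w ^ Suc k)" .
  qed
  moreover have "\<dots> = 1 / (2 * \<i>) * (2 * pi * \<i> * bateman k t)"
    unfolding \<gamma>_def
    by (intro contour_integral_unique has_contour_integral_lmul bateman_circlepath) auto
  ultimately have "1 / (2 * \<i>) * (2 * pi * \<i> * bateman k t) = 2 * pi * \<i> * residue f \<i>"
    using wn by simp
  then have "bateman k t = 2 * \<i> * residue f \<i>"
    by (simp add: field_simps)
  then show ?thesis by (simp add: f_def)
qed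

section \<open>Passage to the unit circle\<close>

lemma norm_bateman_gen_le_1:
  assumes "t \<ge> 0" "norm w \<le> 1"
  shows "norm (bateman_gen t w) \<le> 1"
proof -
  \<comment> \<open>This includes \<open>w = 1\<close>: division by zero yields 0 on both sides, and
    \<open>bateman_gen t 1\<close> is 1.\<close>
  have "Re ((1 + w) / (1 - w)) = (1 - (norm w)\<^sup>2) / (norm (1 - w))\<^sup>2"
    by (simp add: Re_divide' cmod_power2) (simp add: power2_eq_square algebra_simps)
  also have "\<dots> \<ge> 0"
    using assms(2) by (simp add: power_le_one)
  finally have "0 \<le> t * Re ((1 + w) / (1 - w))"
    using assms(1) by simp
  then show ?thesis
    unfolding bateman_gen_def norm_exp_eq_Re by (simp del: times_divide_eq_right)
qed

text \<open>Parametrising by the angle gives \<open>dw = i * w d\<theta>\<close>, which cancels one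
  power of \<open>w\<close>; hence \<open>k\<close> here in place of \<open>Suc k\<close>.\<close>

lemma bateman_has_integral_circle:
  fixes r :: real
  assumes "0 < r" "r < 1"
  shows "((\<lambda>\<theta>. bateman_gen t (r * cis \<theta>) / (r * cis \<theta>) ^ k) has_integral 2 * pi * bateman k t)
           {0..2 * pi}"
proof -
  have "((\<lambda>\<theta>. bateman_gen t (0 + r * cis \<theta>) / (0 + r * cis \<theta>) ^ Suc k * r * \<i> * cis \<theta>)
          has_integral 2 * pi * \<i> * bateman k t) {0..2 * pi}"
    using bateman_circlepath[OF assms, of t k] unfolding circlepath_def
    by (subst (asm) has_contour_integral_part_circlepath_iff) auto
  then have "((\<lambda>\<theta>. (bateman_gen t (0 + r * cis \<theta>) / (0 + r * cis \<theta>) ^ Suc k * r * \<i> * cis \<theta>) / \<i>)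
          has_integral 2 * pi * \<i> * bateman k t / \<i>) {0..2 * pi}"
    by (rule has_integral_divide)
  then show ?thesis
    by (rule has_integral_eq_rhs[OF has_integral_eq[rotated]])
      (use assms in \<open>simp_all add: divide_simps, simp add: mult.commute\<close>)
qed

text \<open>The singularity at \<open>w = 1\<close> corresponds to the angles 0 and
  \<open>2 * pi\<close>, so the open interval avoids it:
  \<open>1 - cos \<theta> = 2 * sin (\<theta>/2)^2\<close> is positive there.\<close>

lemma isCont_bateman_gen_circle:
  assumes "0 < \<theta>" "\<theta> < 2 * pi"
  shows "isCont (bateman_gen t) (cis \<theta>)"
proof -
  have "sin (\<theta> / 2) > 0"
    using assms by (intro sin_gt_zero) auto
  then have "cos \<theta> < 1"
    using cos_double_sin[of "\<theta> / 2"] by simp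
  then have "cis \<theta> \<noteq> 1"
    by (auto simp: complex_eq_iff)
  then show ?thesis
    unfolding bateman_gen_def by (intro continuous_intros) auto
qed

lemma isCont_cis: "isCont cis x"
  using continuous_on_cis[of UNIV "\<lambda>x. x"] by (simp add: continuous_on_eq_continuous_at)

lemma isCont_bateman_gen_cis:
  assumes "0 < \<theta>" "\<theta> < 2 * pi"
  shows "isCont (\<lambda>\<theta>. bateman_gen t (cis \<theta>) / cis \<theta> ^ k) \<theta>"
  using isCont_o2[OF isCont_cis isCont_bateman_gen_circle[OF assms]] isCont_cis
  by (intro continuous_intros) auto

lemma bateman_eq_integral_unit_circle:
  assumes "t \<ge> 0"
  shows "set_integrable lborel {0<..<2 * pi} (\<lambda>\<theta>. bateman_gen t (cis \<theta>) / cis \<theta> ^ k)"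
    and "(LINT \<theta>:{0<..<2 * pi}|lborel. bateman_gen t (cis \<theta>) / cis \<theta> ^ k) = 2 * pi * bateman k t"
proof -
  let ?g = "\<lambda>\<theta>. bateman_gen t (cis \<theta>) / cis \<theta> ^ k"
  \<comment> \<open>Radii increasing to 1 from 1/2. The lower bound 1/2 gives the dominating
    constant \<open>2 ^ k\<close> for \<open>1 / r n ^ k\<close>.\<close>
  define r where "r n = 1 - inverse (real (Suc n)) / 2" for n
  have r: "1 / 2 \<le> r n" "r n < 1" for n
    by (auto simp: r_def field_simps)
  have lim_r: "r \<longlonglongrightarrow> 1"
    unfolding r_def by (rule tendsto_eq_intros LIMSEQ_inverse_real_of_nat | simp)+
  define f where "f n \<theta> = bateman_gen t (r n * cis \<theta>) / (r n * cis \<theta>) ^ k" for n \<theta>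
  have f: "(f n has_integral 2 * pi * bateman k t) {0<..<2 * pi}" for n
    using bateman_has_integral_circle[of "r n" t k] r[of n]
    unfolding f_def by (subst has_integral_Icc_iff_Ioo[symmetric]) auto
  have le: "norm (f n \<theta>) \<le> 2 ^ k" for n \<theta>
  proof -
    have "norm (f n \<theta>) = norm (bateman_gen t (r n * cis \<theta>)) * (1 / r n) ^ k"
      using r[of n] by (simp add: f_def norm_divide norm_mult norm_power power_divide)
    also have "\<dots> \<le> 1 * 2 ^ k"
      using r[of n] assms
      by (intro mult_mono power_mono norm_bateman_gen_le_1) (auto simp: field_simps norm_mult)
    finally show ?thesis by simp
  qed
  have conv: "(\<lambda>n. f n \<theta>) \<longlonglongrightarrow> ?g \<theta>" if "\<theta> \<in> {0<..<2 * pi}" for \<theta>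
  proof -
    have *: "(\<lambda>n. r n * cis \<theta>) \<longlonglongrightarrow> cis \<theta>"
      using tendsto_mult_right[OF tendsto_of_real[OF lim_r], of "cis \<theta>"] by simp
    have "(\<lambda>n. bateman_gen t (r n * cis \<theta>)) \<longlonglongrightarrow> bateman_gen t (cis \<theta>)"
      by (rule isCont_tendsto_compose[OF isCont_bateman_gen_circle *]) (use that in auto)
    then show ?thesis
      unfolding f_def using * by (intro tendsto_intros) auto
  qed
  have "(\<lambda>_. 2 ^ k :: real) integrable_on {0<..<2 * pi}"
    by (simp add: integrable_const_ivl flip: integrable_on_Icc_iff_Ioo)
  then have "(\<lambda>n. integral {0<..<2 * pi} (f n)) \<longlonglongrightarrow> integral {0<..<2 * pi} ?g"
    using has_integral_integrable[OF f] le conv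
    by (intro dominated_convergence(2)[where h = "\<lambda>_. 2 ^ k"])
  \<comment> \<open>The integrals of \<open>f n\<close> do not depend on \<open>n\<close>, so their
    limit is this common value.\<close>
  then have int: "integral {0<..<2 * pi} ?g = 2 * pi * bateman k t"
    unfolding integral_unique[OF f] by (simp add: LIMSEQ_const_iff)
  \<comment> \<open>The limit was taken for the gauge integral. Absolute integrability, from the
    bound 1 on the unit circle, lets its value carry over to the Lebesgue integral.\<close>
  show *: "set_integrable lborel {0<..<2 * pi} ?g"
    unfolding set_integrable_def
  proof (rule Bochner_Integration.integrable_bound)
    show "integrable lborel (indicator {0<..<2 * pi} :: real \<Rightarrow> real)"
      by simp
    have "continuous_on {0<..<2 * pi} ?g"
      by (intro continuous_at_imp_continuous_on ballI isCont_bateman_gen_cis) auto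
    then show "(\<lambda>\<theta>. indicator {0<..<2 * pi} \<theta> *\<^sub>R ?g \<theta>) \<in> borel_measurable lborel"
      by (simp add: borel_measurable_continuous_on_indicator)
    show "AE \<theta> in lborel. norm (indicator {0<..<2 * pi} \<theta> *\<^sub>R ?g \<theta>)
            \<le> norm (indicator {0<..<2 * pi} \<theta> :: real)"
      using assms by (auto simp: norm_divide norm_power norm_bateman_gen_le_1 indicator_def)
  qed
  show "(LINT \<theta>:{0<..<2 * pi}|lborel. ?g \<theta>) = 2 * pi * bateman k t"
    using set_borel_integral_eq_integral(2)[OF *] int by simp
qed

section \<open>Passage to the real line\<close>

lemma cis_2_arctan: "cis (2 * arctan x) = (1 + \<i> * x) / (1 - \<i> * x)"
proof -
  have "1 + (complex_of_real x)\<^sup>2 \<noteq> 0"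
    by (metis of_real_1 of_real_add of_real_eq_0_iff of_real_power power_one sum_power2_eq_zero_iff zero_neq_one)
  \<comment> \<open>Polar form of \<open>1 + i * x\<close>; squaring it doubles the angle, and the
    squared modulus factors as \<open>(1 + i * x) * (1 - i * x)\<close>.\<close>
  have "cis (arctan x) = (1 + \<i> * x) / sqrt (1 + x\<^sup>2)"
    by (simp add: complex_eq_iff cos_arctan sin_arctan)
  then have "cis (2 * arctan x) = ((1 + \<i> * x) / sqrt (1 + x\<^sup>2)) ^ 2"
    by (metis cis_mult mult_2 power2_eq_square)
  also have "\<dots> = (1 + \<i> * x)\<^sup>2 / (1 + (complex_of_real x)\<^sup>2)"
    by (simp add: power_divide flip: of_real_power)
  also have "1 + (complex_of_real x)\<^sup>2 = (1 + \<i> * x) * (1 - \<i> * x)"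
    by (simp add: algebra_simps power2_eq_square)
  finally show ?thesis
    using \<open>1 + _ \<noteq> 0\<close> by (simp add: power2_eq_square)
qed


text \<open>For real \<tau> both \<open>\<tau> + i\<close> and \<open>\<tau> - i\<close> have
  modulus \<open>sqrt (1 + \<tau>^2)\<close> and the exponential has modulus 1, so the integrand has
  modulus exactly \<open>1 / (1 + \<tau>^2)\<close>.\<close>

lemma integrable_bateman_integrand:
  assumes "k \<ge> 1"
  shows "integrable lborel (\<lambda>\<tau>::real. exp (\<i> * of_real t * of_real \<tau>) *
           ((of_real \<tau> + \<i>) ^ (k - 1) / (of_real \<tau> - \<i>) ^ (k + 1)))" (is "integrable _ ?f")
proof (rule Bochner_Integration.integrable_bound)
  show "integrable lborel (\<lambda>\<tau>::real. inverse (1 + \<tau>\<^sup>2))"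
    using integrable_inverse_1_plus_square by (simp add: set_integrable_def)
  show "?f \<in> borel_measurable lborel"
    by measurable
  show "AE \<tau> in lborel. norm (?f \<tau>) \<le> norm (inverse (1 + \<tau>\<^sup>2))"
  proof (intro AE_I2)
    fix \<tau> :: real
    obtain m where k: "k = Suc m" using assms by (cases k) auto
    have n: "norm (of_real \<tau> + \<i>) = sqrt (1 + \<tau>\<^sup>2)" "norm (of_real \<tau> - \<i>) = sqrt (1 + \<tau>\<^sup>2)"
      by (simp_all add: cmod_def add.commute)
    have pos: "1 + \<tau>\<^sup>2 > 0" by (simp add: add_pos_nonneg)
    have "norm (?f \<tau>) = sqrt (1 + \<tau>\<^sup>2) ^ m / sqrt (1 + \<tau>\<^sup>2) ^ (m + 2)"
      by (simp add: norm_mult norm_divide norm_power n k)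
    also have "\<dots> = 1 / (sqrt (1 + \<tau>\<^sup>2))\<^sup>2"
      using pos by (simp add: power_add)
    finally show "norm (?f \<tau>) \<le> norm (inverse (1 + \<tau>\<^sup>2))"
      using pos by (simp add: inverse_eq_divide)
  qed
qed

theorem theorem1:
  fixes k :: nat and t :: real
  assumes "k \<ge> 1" and "t \<ge> 0"
  shows "integrable lborel (\<lambda>\<tau>::real. exp (\<i> * of_real t * of_real \<tau>) *
           ((of_real \<tau> + \<i>) ^ (k - 1) / (of_real \<tau> - \<i>) ^ (k + 1)))
    \<and> bateman k t = 1 / of_real pi *
           (LINT \<tau>::real|lborel. exp (\<i> * of_real t * of_real \<tau>) *
             ((of_real \<tau> + \<i>) ^ (k - 1) / (of_real \<tau> - \<i>) ^ (k + 1)))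
    \<and> bateman k t = 2 * \<i> *
           residue (\<lambda>z. exp (\<i> * of_real t * z) * ((z + \<i>) ^ (k - 1) / (z - \<i>) ^ (k + 1))) \<i>"
proof (intro conjI)
  define f where "f = (\<lambda>\<tau>::real. exp (\<i> * of_real t * of_real \<tau>) *
           ((of_real \<tau> + \<i>) ^ (k - 1) / (of_real \<tau> - \<i>) ^ (k + 1)))"
  define F where "F = (\<lambda>\<theta>. bateman_gen t (cis \<theta>) / cis \<theta> ^ k)"
  \<comment> \<open>The argument of the point of the unit circle that the Moebius map sends to \<open>\<tau>\<close>.\<close>
  define g where "g = (\<lambda>\<tau>. 2 * arctan \<tau> + pi)"
  have range_g: "0 < g \<tau>" "g \<tau> < 2 * pi" for \<tau>
    using arctan_bounded[of \<tau>] by (auto simp: g_def)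
  have Fg: "(2 * inverse (1 + \<tau>\<^sup>2)) *\<^sub>R F (g \<tau>) = 2 * f \<tau>" for \<tau>
  proof -
    have ne: "of_real \<tau> + \<i> \<noteq> 0" "of_real \<tau> - \<i> \<noteq> 0"
      by (auto simp: complex_eq_iff)
    have i: "1 - \<i> * \<tau> = - \<i> * (\<tau> + \<i>)" "1 + \<i> * \<tau> = \<i> * (\<tau> - \<i>)"
      by (simp_all add: algebra_simps)
    \<comment> \<open>The shift by \<open>pi\<close> in \<open>g\<close> supplies the minus sign
      that makes this the inverse Moebius map.\<close>
    have "cis (g \<tau>) = - ((1 + \<i> * \<tau>) / (1 - \<i> * \<tau>))"
      by (simp add: g_def cis_2_arctan flip: cis_mult)
    also have "\<dots> = (\<tau> - \<i>) / (\<tau> + \<i>)"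
      unfolding i using ne by simp
    finally have w: "cis (g \<tau>) = (\<tau> - \<i>) / (\<tau> + \<i>)" .
    have d: "1 - cis (g \<tau>) = 2 * \<i> / (\<tau> + \<i>)" "1 + cis (g \<tau>) = 2 * \<tau> / (\<tau> + \<i>)"
      unfolding w using ne by (simp_all add: divide_simps)
    have "\<i> * (1 + cis (g \<tau>)) / (1 - cis (g \<tau>)) = \<tau>"
      unfolding d using ne by simp
    moreover have "cis (g \<tau>) \<noteq> 1"
      using d(1) ne by auto
    \<comment> \<open>The extra \<open>1 / cis (g \<tau>)\<close> appears because \<open>F\<close>
      divides by the \<open>k\<close>-th power only. Together with the squared factor it becomes
      \<open>1 / (1 + \<tau>^2)\<close>, half the derivative of \<open>g\<close>.\<close>
    ultimately have "f \<tau> = F (g \<tau>) * (1 / cis (g \<tau>) * ((1 - cis (g \<tau>))\<^sup>2 / (2 * \<i>)\<^sup>2))"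
      using cayley_integrand[of "cis (g \<tau>)" k t] assms(1) by (simp add: f_def F_def)
    also have "(1 - cis (g \<tau>))\<^sup>2 / (2 * \<i>)\<^sup>2 = 1 / (\<tau> + \<i>)\<^sup>2"
      unfolding d by (simp add: power_divide)
    also have "1 / cis (g \<tau>) * (1 / (\<tau> + \<i>)\<^sup>2) = 1 / ((\<tau> + \<i>) * (\<tau> - \<i>))"
      unfolding w using ne by (simp add: power2_eq_square)
    also have "(\<tau> + \<i>) * (\<tau> - \<i>) = of_real (1 + \<tau>\<^sup>2)"
      by (simp add: algebra_simps power2_eq_square)
    finally show ?thesis
      by (simp add: scaleR_conv_of_real inverse_eq_divide)
  qed
  show int: "integrable lborel f"
    unfolding f_def by (rule integrable_bateman_integrand[OF assms(1)])
  \<comment> \<open>Substitution \<theta> = \<open>g \<tau>\<close>, where \<open>g\<close>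
    increases from 0 to \<open>2 * pi\<close>. The endpoints are only limits of \<open>g\<close>, so
    integrability is supplied on both open intervals.\<close>
  have "(LBINT \<theta>=ereal 0..ereal (2 * pi). F \<theta>)
      = (LBINT \<tau>=-\<infinity>..\<infinity>. (2 * inverse (1 + \<tau>\<^sup>2)) *\<^sub>R F (g \<tau>))"
  proof (rule interval_integral_substitution_integrable)
    show "DERIV g \<tau> :> 2 * inverse (1 + \<tau>\<^sup>2)" for \<tau>
      unfolding g_def by (auto intro!: derivative_eq_intros)
    show "isCont F (g \<tau>)" for \<tau>
      unfolding F_def by (rule isCont_bateman_gen_cis[OF range_g])
    show "isCont (\<lambda>\<tau>. 2 * inverse (1 + \<tau>\<^sup>2)) \<tau>" for \<tau> :: real
      by (intro continuous_intros) (metis add_pos_nonneg less_irrefl zero_le_power2 zero_less_one)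
    have "(g \<longlongrightarrow> 0) at_bot"
      unfolding g_def by (rule tendsto_eq_intros tendsto_arctan_at_bot | simp)+
    then show "((ereal \<circ> g \<circ> real_of_ereal) \<longlongrightarrow> ereal 0) (at_right (- \<infinity>))"
      by (simp add: ereal_tendsto_simps)
    have "(g \<longlongrightarrow> 2 * pi) at_top"
      unfolding g_def by (rule tendsto_eq_intros tendsto_arctan_at_top | simp)+
    then show "((ereal \<circ> g \<circ> real_of_ereal) \<longlongrightarrow> ereal (2 * pi)) (at_left \<infinity>)"
      by (simp add: ereal_tendsto_simps)
    show "set_integrable lborel (einterval (ereal 0) (ereal (2 * pi))) F"
      using bateman_eq_integral_unit_circle(1)[OF assms(2)] by (simp add: F_def)
    show "set_integrable lborel (einterval (- \<infinity>) \<infinity>) (\<lambda>\<tau>. (2 * inverse (1 + \<tau>\<^sup>2)) *\<^sub>R F (g \<tau>))"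
      unfolding Fg using int by (simp add: set_integrable_def)
  qed auto
  also have "\<dots> = 2 * (LINT \<tau>|lborel. f \<tau>)"
    unfolding Fg by (simp add: interval_lebesgue_integral_def set_lebesgue_integral_def)
  finally have "2 * pi * bateman k t = 2 * (LINT \<tau>|lborel. f \<tau>)"
    using bateman_eq_integral_unit_circle(2)[OF assms(2), of k]
    by (simp add: F_def interval_lebesgue_integral_def)
  then show "bateman k t = 1 / of_real pi * (LINT \<tau>|lborel. f \<tau>)"
    by (simp add: field_simps)
qed (rule bateman_eq_residue[OF assms(1)])

end
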